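(* Let $\mathcal{A}$ be the set of all prime numbers $p$ such that $v_p(n-1)=v_p(D_n)$ for all $n\in\mathbb{N}$, and let $\mathcal{B}$ be the set of all prime numbers not in $\mathcal{A}$. Then the set $\mathcal{B}$ is infinite.
   Context: $\mathbb{N}=\{0,1,2,\dots\}$. $(D_n)_{n\in\mathbb{N}}$ is the sequence of numbers of derangements: $D_0=1$, $D_n=nD_{n-1}+(-1)^n$ for $n>0$. $v_p$ is the $p$-adic valuation with $v_p(0)=+\infty$. *)

theory Defs
  imports "HOL-Computational_Algebra.Primes" "HOL-Library.Extended_Nat"
begin

fun derangements :: "nat \<Rightarrow> int" where
  "derangements 0 = 1"
| "derangements (Suc n) = int (Suc n) * derangements n + (-1) ^ Suc n"

text \<open>
  The library's \<^const>\<open>multiplicity\<close> is \<open>0\<close> at \<open>0\<close>, so the value \<open>\<infinity>\<close> has to be set explicitly.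
\<close>

definition padic_val :: "nat \<Rightarrow> int \<Rightarrow> enat" where
  "padic_val p x = (if x = 0 then \<infinity> else enat (multiplicity (int p) x))"

text \<open>
  The difference \<open>n - 1\<close> is taken in the integers: it is \<open>-1\<close> for \<open>n = 0\<close>.
\<close>

definition set_A :: "nat set" where
  "set_A = {p. prime p \<and> (\<forall>n::nat. padic_val p (int n - 1) = padic_val p (derangements n))}"

definition set_B :: "nat set" where
  "set_B = {p. prime p \<and> p \<notin> set_A}"

end

theory Submission
  imports Defs
begin

text \<open>
  Since \<open>D\<^sub>m\<^sub>+\<^sub>2 = (m + 1) (D\<^sub>m\<^sub>+\<^sub>1 + D\<^sub>m)\<close>, every prime divisor of some \<open>D\<^sub>m\<^sub>+\<^sub>1 + D\<^sub>m\<close>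
  lies in \<open>\<B>\<close>. As in Euclid's argument, if \<open>\<B>\<close> were finite, let \<open>m\<close> be twice the product
  of its elements; the recurrence gives \<open>D\<^sub>m\<^sub>+\<^sub>1 + D\<^sub>m \<equiv> \<plusminus>1\<close> modulo \<open>m\<close>, so that any prime divisor
  of \<open>D\<^sub>m\<^sub>+\<^sub>1 + D\<^sub>m > 1\<close> is both in \<open>\<B>\<close> and outside it.
\<close>

text \<open>The index starts at 2 because \<open>derangements 1\<close> is 0.\<close>

lemma derangements_pos: "derangements (Suc (Suc n)) \<ge> 1"
proof (induction n)
  case 0
  show ?case by simp
next
  case (Suc n)
  have "int (n + 3) * 1 \<le> int (n + 3) * derangements (Suc (Suc n))"
    using Suc.IH by (intro mult_left_mono) auto
  moreover have "(-1) ^ (n + 3) \<ge> (-1::int)"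
    by (cases "even n") auto
  moreover have "derangements (Suc (Suc (Suc n))) =
      int (n + 3) * derangements (Suc (Suc n)) + (-1) ^ (n + 3)"
    by (simp only: derangements.simps(2)[of "Suc (Suc n)"]) (simp add: numeral_3_eq_3)
  ultimately have "int (n + 3) * 1 + (-1) \<le> derangements (Suc (Suc (Suc n)))"
    by (metis add_mono)
  then show ?case
    by (simp del: derangements.simps)
qed

lemma derangements_Suc_Suc:
  "derangements (Suc (Suc n)) = int (Suc n) * (derangements (Suc n) + derangements n)"
  by (simp add: algebra_simps)

lemma dvd_derangements_minus_sign: "int m dvd derangements m - (-1) ^ m"
  by (cases m) simp_all

text \<open>Modulo \<open>m\<close> the sum is \<open>2 * derangements m - (-1) ^ m\<close>, and
  \<open>derangements m\<close> is itself \<open>(-1) ^ m\<close>.\<close>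

lemma dvd_derangements_add_minus_sign:
  "int m dvd derangements (Suc m) + derangements m - (-1) ^ m"
proof -
  have "derangements (Suc m) + derangements m - (-1) ^ m =
      int m * derangements m + 2 * (derangements m - (-1) ^ m)"
    by (simp add: algebra_simps)
  then show ?thesis
    using dvd_derangements_minus_sign[of m] by (metis dvd_add dvd_mult dvd_triv_left)
qed

text \<open>The defining equality of \<open>set_A\<close> fails at the index \<open>m + 2\<close>:
  there the right side exceeds the left by the valuation of the sum.\<close>

lemma prime_dvd_derangements_add_imp_set_B:
  assumes p: "prime p" and dvd: "int p dvd derangements (Suc m) + derangements m"
  shows "p \<in> set_B"
proof -
  let ?s = "derangements (Suc m) + derangements m"
  have prime: "prime (int p)"
    using p by simp
  \<comment> \<open>Multiplicity is 0 at 0, so the lower bound needs this; the sum divides a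
    positive number.\<close>
  have "?s \<noteq> 0"
    using derangements_pos[of m] derangements_Suc_Suc[of m] by auto
  then have "multiplicity (int p) ?s \<ge> 1"
    using dvd prime by (intro multiplicity_geI) (auto simp: not_prime_unit)
  moreover have "multiplicity (int p) (int (Suc m) * ?s) =
      multiplicity (int p) (int (Suc m)) + multiplicity (int p) ?s"
    using prime \<open>?s \<noteq> 0\<close> by (intro prime_elem_multiplicity_mult_distrib) auto
  ultimately have "padic_val p (int (Suc (Suc m)) - 1) \<noteq> padic_val p (derangements (Suc (Suc m)))"
    using derangements_pos[of m]
    by (auto simp: padic_val_def derangements_Suc_Suc simp del: derangements.simps)
  then show ?thesis
    using p unfolding set_B_def set_A_def by blast
qed

theorem proposition3:
  shows "infinite set_B"
proof
  assume fin: "finite set_B"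
  \<comment> \<open>The factor 2 forces \<open>m \<ge> 2\<close> even if \<open>set_B\<close> is
    empty; \<open>m = 1\<close> would give the sum 1, which has no prime divisor.\<close>
  define m where "m = 2 * \<Prod>set_B"
  let ?s = "derangements (Suc m) + derangements m"
  have "\<Prod>set_B > 0"
    by (intro prod_pos) (auto simp: set_B_def prime_gt_0_nat)
  then have "2 \<le> m"
    unfolding m_def by linarith
  then obtain k where k: "m = Suc (Suc k)"
    using le_Suc_ex[of 2 m] by auto
  have "?s \<ge> 2"
    using derangements_pos[of k] derangements_pos[of "Suc k"] unfolding k by linarith
  then have "nat ?s \<noteq> 1"
    by linarith
  then obtain q where q: "prime q" "q dvd nat ?s"
    using prime_factor_nat by blast
  then have dvd: "int q dvd ?s"
    by (subst (asm) int_dvd_int_iff[symmetric]) (use \<open>?s \<ge> 2\<close> in auto)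
  then have "q \<in> set_B"
    using prime_dvd_derangements_add_imp_set_B q(1) by blast
  then have "q dvd m"
    using fin unfolding m_def by (intro dvd_mult dvd_prodI)
  then have "int q dvd ?s - (-1) ^ m"
    using dvd_derangements_add_minus_sign[of m] by (meson dvd_trans of_nat_dvd_iff)
  then have "int q dvd ?s - (?s - (-1) ^ m)"
    using dvd by (rule dvd_diff[rotated])
  then have "is_unit (int q)"
    by (cases "even m") (auto simp del: derangements.simps)
  then show False
    using q(1) by simp
qed

end
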